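(* Let $F_\theta:\mathbb{R}^d\to\mathbb{R}$ be a real-valued function with parameter $\theta$, let $T:\mathbb{R}^d\to\mathbb{R}^m$ be a function with no learnable parameters, and let $\eta\in\mathbb{R}^m$ be a parameter. Consider the probability density $$p_{\theta,\eta}(x)=\frac{\exp\left(F_\theta(x)+\eta^\top T(x)\right)}{Z(\theta,\eta)},\qquad Z(\theta,\eta)=\int\exp\left(F_\theta(x)+\eta^\top T(x)\right)dx,$$ and, for data points $x_1,\dots,x_N\in\mathbb{R}^d$, the log-likelihood $$l(\theta,\eta)=\sum_{i=1}^N F_\theta(x_i)+\sum_{i=1}^N\eta^\top T(x_i)-N A(\theta,\eta),\qquad A(\theta,\eta)=\log Z(\theta,\eta).$$ If the parameter $\eta$ is at a local maximum of $l(\theta,\eta)$ for a fixed $\theta$, then $$\mathbb{E}_{p_{\theta,\eta}}[T(x)]=\frac1N\sum_{i=1}^N T(x_i).$$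
   Context: The density $p_{\theta,\eta}$ is a "hybrid" energy-based model: $F_\theta$ is constructed with a neural network parameterized by $\theta$, and $T$ is a fixed statistic function that enters through the linear term $\eta^\top T(x)$ with learnable parameter $\eta$. $Z(\theta,\eta)$ is the partition function of the model. The function $l(\theta,\eta)$ equals $\sum_{i=1}^N\log p_{\theta,\eta}(x_i)$. The expectation $\mathbb{E}_{p_{\theta,\eta}}[T(x)]$ is the mean of $T(x)$ when $x$ has density $p_{\theta,\eta}$. *)

theory Defs
  imports "HOL-Probability.Probability"
begin

definition ebm_weight ::
    "('p \<Rightarrow> real ^ 'd \<Rightarrow> real) \<Rightarrow> (real ^ 'd \<Rightarrow> real ^ 'm) \<Rightarrow> 'p \<Rightarrow> real ^ 'm \<Rightarrow> real ^ 'd \<Rightarrow> real"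
  where "ebm_weight F T \<theta> \<eta> x = exp (F \<theta> x + \<eta> \<bullet> T x)"

(* The Bochner integral is 0 where the weight is not integrable, so Z, and with it A, the density
   and the log-likelihood, carry their intended meaning only for eta in eta_space below. *)
definition partition_function ::
    "('p \<Rightarrow> real ^ 'd \<Rightarrow> real) \<Rightarrow> (real ^ 'd \<Rightarrow> real ^ 'm) \<Rightarrow> 'p \<Rightarrow> real ^ 'm \<Rightarrow> real"
  where "partition_function F T \<theta> \<eta> = (LINT x|lebesgue. ebm_weight F T \<theta> \<eta> x)"

(* The parameters eta for which Z is finite, that is, for which the density exists: Z > 0 is
   automatic, since the weight is strictly positive. *)
definition eta_space ::
    "('p \<Rightarrow> real ^ 'd \<Rightarrow> real) \<Rightarrow> (real ^ 'd \<Rightarrow> real ^ 'm) \<Rightarrow> 'p \<Rightarrow> (real ^ 'm) set"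
  where "eta_space F T \<theta> = {\<eta>. integrable lebesgue (ebm_weight F T \<theta> \<eta>)}"

definition ebm_pdf ::
    "('p \<Rightarrow> real ^ 'd \<Rightarrow> real) \<Rightarrow> (real ^ 'd \<Rightarrow> real ^ 'm) \<Rightarrow> 'p \<Rightarrow> real ^ 'm \<Rightarrow> real ^ 'd \<Rightarrow> real"
  where "ebm_pdf F T \<theta> \<eta> x = ebm_weight F T \<theta> \<eta> x / partition_function F T \<theta> \<eta>"

definition ebm_measure ::
    "('p \<Rightarrow> real ^ 'd \<Rightarrow> real) \<Rightarrow> (real ^ 'd \<Rightarrow> real ^ 'm) \<Rightarrow> 'p \<Rightarrow> real ^ 'm \<Rightarrow> (real ^ 'd) measure"
  where "ebm_measure F T \<theta> \<eta> = density lebesgue (\<lambda>x. ennreal (ebm_pdf F T \<theta> \<eta> x))"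

definition log_partition ::
    "('p \<Rightarrow> real ^ 'd \<Rightarrow> real) \<Rightarrow> (real ^ 'd \<Rightarrow> real ^ 'm) \<Rightarrow> 'p \<Rightarrow> real ^ 'm \<Rightarrow> real"
  where "log_partition F T \<theta> \<eta> = ln (partition_function F T \<theta> \<eta>)"

definition log_likelihood ::
    "('p \<Rightarrow> real ^ 'd \<Rightarrow> real) \<Rightarrow> (real ^ 'd \<Rightarrow> real ^ 'm) \<Rightarrow> nat \<Rightarrow> (nat \<Rightarrow> real ^ 'd)
      \<Rightarrow> 'p \<Rightarrow> real ^ 'm \<Rightarrow> real"
  where "log_likelihood F T N x \<theta> \<eta> =
    (\<Sum>i=1..N. F \<theta> (x i)) + (\<Sum>i=1..N. \<eta> \<bullet> T (x i)) - real N * log_partition F T \<theta> \<eta>"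

definition local_max_at :: "('a::topological_space \<Rightarrow> real) \<Rightarrow> 'a \<Rightarrow> bool"
  where "local_max_at f a \<longleftrightarrow> (\<forall>\<^sub>F y in nhds a. f y \<le> f a)"

end

(* Fix a coordinate direction b and put c = (1/N) sum (b . T(x_i)), u = b . T - c. Local maximality
   of the log-likelihood along the line eta + t b says exactly that t |-> int w exp (t u), with
   w = exp (F + eta . T), is minimal at t = 0. Since eta is interior to the domain of finiteness,
   exp (t u) - 1 - t u is bounded by t^2 times a w-integrable function, so int w u = 0, which is
   the b-component of the moment identity. *)
theory Submission
  imports Defs
begin

text \<open>The Taylor remainder is \<open>exp s / 2 * (t * v)^2\<close> with \<open>s\<close>
  bounded by half of \<open>r * \<bar>v\<bar>\<close>. Half of the exponent
  \<open>r * \<bar>v\<bar>\<close> absorbs \<open>exp s\<close>, the other half absorbs the square.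
  In the resulting bound \<open>t\<close> survives only as a factor \<open>t^2\<close>, so it can be
  integrated once for all small \<open>t\<close>.\<close>

lemma exp_remainder_le:
  fixes t v r :: real
  assumes "r > 0" "\<bar>t\<bar> \<le> r / 2"
  shows "exp (t * v) \<le> 1 + t * v + t\<^sup>2 * (4 / r\<^sup>2 * (exp (r * v) + exp (- (r * v))))"
proof -
  obtain s where s: "\<bar>s\<bar> \<le> \<bar>t * v\<bar>"
    "exp (t * v) = (\<Sum>m<2. (t * v) ^ m / fact m) + exp s / fact 2 * (t * v) ^ 2"
    using Maclaurin_exp_le by blast
  define y where "y = r / 2 * \<bar>v\<bar>"
  have y0: "y \<ge> 0" using assms by (simp add: y_def)
  have "\<bar>t * v\<bar> \<le> y"
    unfolding y_def abs_mult using assms by (intro mult_right_mono) auto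
  then have es: "exp s \<le> exp y" using s(1) by simp
  have "y\<^sup>2 / 2 \<le> exp y" using exp_lower_Taylor_quadratic[OF y0] y0 by linarith
  then have "exp s * (y\<^sup>2 / 2) \<le> exp y * exp y"
    using es by (intro mult_mono) auto
  also have "\<dots> = exp \<bar>r * v\<bar>"
    using assms by (simp add: y_def abs_mult flip: exp_add)
  also have "\<dots> \<le> exp (r * v) + exp (- (r * v))"
    by (cases "r * v \<ge> 0") auto
  \<comment> \<open>The factor \<open>4 / r^2\<close> cancels the \<open>(r / 2)^2\<close> inside
    \<open>y^2\<close>, which restores \<open>(t * v)^2\<close>.\<close>
  finally have "t\<^sup>2 * (4 / r\<^sup>2) * (exp s * (y\<^sup>2 / 2))
      \<le> t\<^sup>2 * (4 / r\<^sup>2) * (exp (r * v) + exp (- (r * v)))"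
    by (intro mult_left_mono) auto
  moreover have "t\<^sup>2 * (4 / r\<^sup>2) * (exp s * (y\<^sup>2 / 2)) = exp s / 2 * (t * v)\<^sup>2"
    using assms by (simp add: y_def power2_eq_square field_simps)
  moreover have "exp (t * v) = 1 + t * v + exp s / 2 * (t * v)\<^sup>2"
    using s(2) by (simp add: eval_nat_numeral)
  ultimately show ?thesis by (simp only: mult.assoc)
qed

text \<open>The expression vanishes at \<open>t = 0\<close>, so 0 is a local minimum, and its
  derivative there is \<open>a\<close>.\<close>

lemma linear_coeff_zero_if_nonneg:
  fixes a C r :: real
  assumes "r > 0" and nonneg: "\<And>t. \<bar>t\<bar> \<le> r \<Longrightarrow> 0 \<le> t * a + t\<^sup>2 * C"
  shows "a = 0"
proof -
  have "((\<lambda>t. t * a + t\<^sup>2 * C) has_real_derivative a) (at 0)"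
    by (auto intro!: derivative_eq_intros)
  then show ?thesis
    by (rule DERIV_local_min[OF _ assms(1)]) (auto intro: nonneg)
qed

text \<open>A first-order condition obtained without differentiating under the integral: integrating
  the bound of \<open>exp_remainder_le\<close> against \<open>w\<close> and comparing with the
  minimum leaves \<open>0 \<le> t * a + t^2 * C\<close>, where \<open>a\<close> is the integral of
  \<open>w * u\<close>.\<close>

lemma tilted_integral_minimum:
  fixes w u :: "'a \<Rightarrow> real"
  assumes meas: "u \<in> borel_measurable M"
    and w0: "\<And>x. w x \<ge> 0"
    and r: "r > 0"
    and int: "\<And>t. \<bar>t\<bar> \<le> r \<Longrightarrow> integrable M (\<lambda>x. w x * exp (t * u x))"
    and min: "\<And>t. \<bar>t\<bar> \<le> r \<Longrightarrow> (LINT x|M. w x) \<le> (LINT x|M. w x * exp (t * u x))"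
  shows "integrable M (\<lambda>x. w x * u x) \<and> (LINT x|M. w x * u x) = 0"
proof -
  \<comment> \<open>The sum of the tilted weights at the endpoints \<open>t = r\<close> and
    \<open>t = - r\<close>. It dominates \<open>w * u\<close> up to the factor \<open>1 / r\<close>,
    and it controls the quadratic remainder.\<close>
  let ?K = "\<lambda>x. w x * exp (r * u x) + w x * exp (- r * u x)"
  have iw: "integrable M w" using int[of 0] r by simp
  have iK: "integrable M ?K"
    using int[of r] int[of "- r"] r by (intro Bochner_Integration.integrable_add) auto
  have iu: "integrable M (\<lambda>x. w x * u x)"
  proof (rule Bochner_Integration.integrable_bound[OF integrable_mult_right[OF iK, of "1 / r"]])
    show "(\<lambda>x. w x * u x) \<in> borel_measurable M" using iw meas by measurable
    have "norm (w x * u x) \<le> norm (1 / r * ?K x)" for x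
    proof -
      have "\<bar>r * u x\<bar> \<le> exp (r * u x) + exp (- (r * u x))"
        using exp_ge_add_one_self[of "r * u x"] exp_ge_add_one_self[of "- (r * u x)"]
          exp_gt_zero[of "r * u x"] exp_gt_zero[of "- (r * u x)"] by linarith
      then have "r * \<bar>u x\<bar> \<le> exp (r * u x) + exp (- r * u x)"
        using r by (simp add: abs_mult)
      then have "w x * (r * \<bar>u x\<bar>) \<le> w x * (exp (r * u x) + exp (- r * u x))"
        using w0 by (intro mult_left_mono) auto
      then have "w x * \<bar>u x\<bar> \<le> 1 / r * ?K x"
        using r by (simp add: field_simps)
      then show ?thesis using w0[of x] r by (simp add: abs_mult)
    qed
    then show "AE x in M. norm (w x * u x) \<le> norm (1 / r * ?K x)" by simp
  qed
  let ?C = "4 / r\<^sup>2 * (LINT x|M. ?K x)"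
  have "0 \<le> t * (LINT x|M. w x * u x) + t\<^sup>2 * ?C" if t: "\<bar>t\<bar> \<le> r / 2" for t
  proof -
    let ?R = "\<lambda>x. w x + t * (w x * u x) + t\<^sup>2 * (4 / r\<^sup>2 * ?K x)"
    have iR: "integrable M ?R"
      by (rule Bochner_Integration.integrable_add[OF Bochner_Integration.integrable_add[OF
            iw integrable_mult_right[OF iu]] integrable_mult_right[OF integrable_mult_right[OF iK]]])
    have "w x * exp (t * u x) \<le> ?R x" for x
      using mult_left_mono[OF exp_remainder_le[OF r t, of "u x"] w0[of x]]
      by (simp add: algebra_simps)
    then have "(LINT x|M. w x * exp (t * u x)) \<le> (LINT x|M. ?R x)"
      using t r by (intro integral_mono int iR) auto
    also have "\<dots> = (LINT x|M. w x) + t * (LINT x|M. w x * u x) + t\<^sup>2 * ?C"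
      using iw iu iK int[of r] int[of "- r"] r by simp
    finally show ?thesis using min[of t] t r by simp
  qed
  then have "(LINT x|M. w x * u x) = 0"
    using r linear_coeff_zero_if_nonneg[of "r / 2" _ ?C] by simp
  with iu show ?thesis by simp
qed

lemma ebm_weight_shift:
  "ebm_weight F T \<theta> (\<eta> + t *\<^sub>R b) x = ebm_weight F T \<theta> \<eta> x * exp (t * (b \<bullet> T x))"
  by (simp add: ebm_weight_def inner_add_left add.assoc flip: exp_add)

lemma partition_function_pos:
  fixes T :: "real ^ 'd \<Rightarrow> real ^ 'm"
  assumes "\<eta> \<in> eta_space F T \<theta>"
  shows "partition_function F T \<theta> \<eta> > 0"
proof -
  let ?w = "ebm_weight F T \<theta> \<eta>"
  have pos: "?w x > 0" for x by (simp add: ebm_weight_def)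
  have "(LINT x|lebesgue. ?w x) \<noteq> 0"
  proof
    assume "(LINT x|lebesgue. ?w x) = 0"
    then have "AE x in lebesgue. ?w x = 0"
      using integral_nonneg_eq_0_iff_AE[of lebesgue ?w] assms pos
      by (simp add: eta_space_def less_imp_le)
    \<comment> \<open>A false property holding almost everywhere would make the whole space a null
      set.\<close>
    then have "AE x in (lebesgue :: (real ^ 'd) measure). False"
      using pos by (auto elim!: eventually_mono simp: less_le)
    then show False by (simp add: AE_iff_null null_sets_def)
  qed
  moreover have "(LINT x|lebesgue. ?w x) \<ge> 0"
    using pos by (intro integral_nonneg_AE) (simp add: less_imp_le)
  ultimately show ?thesis by (simp add: partition_function_def)
qed

text \<open>Neighbourhoods of \<open>\<eta>\<close> contain balls, so a single radius serves every
  unit direction \<open>b\<close>.\<close>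

lemma eta_interior_segment:
  fixes \<eta> :: "real ^ 'm"
  assumes "\<eta> \<in> interior (eta_space F T \<theta>)" "local_max_at f \<eta>"
  obtains r where "r > 0"
    "\<And>b t. norm b = 1 \<Longrightarrow> \<bar>t\<bar> \<le> r \<Longrightarrow>
      \<eta> + t *\<^sub>R b \<in> eta_space F T \<theta> \<and> f (\<eta> + t *\<^sub>R b) \<le> f \<eta>"
proof -
  obtain r1 where r1: "r1 > 0" "cball \<eta> r1 \<subseteq> eta_space F T \<theta>"
    using assms(1) mem_interior_cball by blast
  obtain r2 where r2: "r2 > 0" "\<And>y. dist y \<eta> < r2 \<Longrightarrow> f y \<le> f \<eta>"
    using assms(2) unfolding local_max_at_def eventually_nhds_metric by blast
  show thesis
  \<comment> \<open>Halving \<open>r2\<close> fits the closed range of \<open>t\<close> into the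
    open ball given by local maximality.\<close>
  proof (rule that[of "min r1 (r2 / 2)"])
    fix b t assume bt: "norm (b :: real ^ 'm) = 1" "\<bar>t\<bar> \<le> min r1 (r2 / 2)"
    have "dist (\<eta> + t *\<^sub>R b) \<eta> = \<bar>t\<bar>" using bt by (simp add: dist_norm)
    then show "\<eta> + t *\<^sub>R b \<in> eta_space F T \<theta> \<and> f (\<eta> + t *\<^sub>R b) \<le> f \<eta>"
      using bt r1 r2 by (auto simp: dist_commute intro!: r2(2) subsetD[OF r1(2)])
  qed (use r1 r2 in auto)
qed

(* Measurability of T is not assumed; it is recovered from that of the weights at eta and eta + r b,
   whose quotient is exp (r (b . T)). *)
lemma statistic_component_measurable:
  assumes "\<eta> \<in> eta_space F T \<theta>" "\<eta> + r *\<^sub>R b \<in> eta_space F T \<theta>" "r \<noteq> 0"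
  shows "(\<lambda>x. b \<bullet> T x) \<in> borel_measurable lebesgue"
proof -
  let ?w = "ebm_weight F T \<theta>"
  have "?w \<eta> \<in> borel_measurable lebesgue" "?w (\<eta> + r *\<^sub>R b) \<in> borel_measurable lebesgue"
    using assms by (auto simp: eta_space_def)
  then have "(\<lambda>x. ln (?w (\<eta> + r *\<^sub>R b) x / ?w \<eta> x) / r) \<in> borel_measurable lebesgue"
    by measurable
  moreover have "ln (?w (\<eta> + r *\<^sub>R b) x / ?w \<eta> x) / r = b \<bullet> T x" for x
    using assms(3) by (simp add: ebm_weight_shift) (simp add: ebm_weight_def)
  ultimately show ?thesis by simp
qed

text \<open>The terms in \<open>F\<close> cancel, and the shift adds \<open>N * t * c\<close> to the
  data term. Dividing by \<open>N > 0\<close> and exponentiating turns the comparison of likelihoods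
  into one of integrals.\<close>

lemma log_likelihood_shift_le_iff:
  fixes x :: "nat \<Rightarrow> real ^ 'd" and T :: "real ^ 'd \<Rightarrow> real ^ 'm"
  assumes "N \<ge> 1" and "\<eta> \<in> eta_space F T \<theta>" "\<eta> + t *\<^sub>R b \<in> eta_space F T \<theta>"
  defines "c \<equiv> b \<bullet> ((1 / real N) *\<^sub>R (\<Sum>i=1..N. T (x i)))"
  shows "log_likelihood F T N x \<theta> (\<eta> + t *\<^sub>R b) \<le> log_likelihood F T N x \<theta> \<eta> \<longleftrightarrow>
    exp (t * c) * partition_function F T \<theta> \<eta> \<le> partition_function F T \<theta> (\<eta> + t *\<^sub>R b)"
proof -
  let ?Z = "partition_function F T \<theta>"
  have Z: "?Z \<eta> > 0" "?Z (\<eta> + t *\<^sub>R b) > 0"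
    using assms(2,3) by (simp_all add: partition_function_pos)
  have "real N * c = (\<Sum>i=1..N. b \<bullet> T (x i))"
    using assms(1) by (simp add: c_def inner_sum_right)
  then have "(\<Sum>i=1..N. (\<eta> + t *\<^sub>R b) \<bullet> T (x i)) = (\<Sum>i=1..N. \<eta> \<bullet> T (x i)) + real N * (t * c)"
    by (simp add: inner_add_left sum.distrib flip: sum_distrib_left)
  then have "log_likelihood F T N x \<theta> (\<eta> + t *\<^sub>R b) \<le> log_likelihood F T N x \<theta> \<eta> \<longleftrightarrow>
      real N * (t * c + ln (?Z \<eta>)) \<le> real N * ln (?Z (\<eta> + t *\<^sub>R b))"
    by (simp add: log_likelihood_def log_partition_def algebra_simps)
  also have "\<dots> \<longleftrightarrow> t * c + ln (?Z \<eta>) \<le> ln (?Z (\<eta> + t *\<^sub>R b))"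
    using assms(1) by simp
  also have "\<dots> \<longleftrightarrow> ln (exp (t * c) * ?Z \<eta>) \<le> ln (?Z (\<eta> + t *\<^sub>R b))"
    using Z by (simp add: ln_mult)
  also have "\<dots> \<longleftrightarrow> exp (t * c) * ?Z \<eta> \<le> ?Z (\<eta> + t *\<^sub>R b)"
    using Z by simp
  finally show ?thesis .
qed

lemma weighted_statistic_component:
  fixes x :: "nat \<Rightarrow> real ^ 'd" and T :: "real ^ 'd \<Rightarrow> real ^ 'm"
  assumes "N \<ge> 1" "r > 0"
    and seg: "\<And>t. \<bar>t\<bar> \<le> r \<Longrightarrow> \<eta> + t *\<^sub>R b \<in> eta_space F T \<theta> \<and>
      log_likelihood F T N x \<theta> (\<eta> + t *\<^sub>R b) \<le> log_likelihood F T N x \<theta> \<eta>"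
  defines "c \<equiv> b \<bullet> ((1 / real N) *\<^sub>R (\<Sum>i=1..N. T (x i)))"
  shows "integrable lebesgue (\<lambda>z. ebm_weight F T \<theta> \<eta> z * (b \<bullet> T z))"
    and "(LINT z|lebesgue. ebm_weight F T \<theta> \<eta> z * (b \<bullet> T z)) = c * partition_function F T \<theta> \<eta>"
proof -
  let ?w = "ebm_weight F T \<theta> \<eta>" and ?u = "\<lambda>z. b \<bullet> T z - c"
  have eta: "\<eta> \<in> eta_space F T \<theta>" using seg[of 0] assms(2) by simp
  then have iw: "integrable lebesgue ?w" by (simp add: eta_space_def)
  \<comment> \<open>Centring at \<open>c\<close> only contributes the constant factor
    \<open>exp (- (t * c))\<close>. Hence the inequality between partition functions below is
    minimality at \<open>t = 0\<close> of the tilted integral.\<close>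
  have tilt: "?w z * exp (t * ?u z) = exp (- (t * c)) * ebm_weight F T \<theta> (\<eta> + t *\<^sub>R b) z" for t z
    by (simp add: ebm_weight_shift right_diff_distrib exp_diff exp_minus field_simps)
  have "integrable lebesgue (\<lambda>z. ?w z * ?u z) \<and> (LINT z|lebesgue. ?w z * ?u z) = 0"
  proof (rule tilted_integral_minimum[OF _ _ assms(2)])
    show "?u \<in> borel_measurable lebesgue"
      using statistic_component_measurable[OF eta, of r b] seg[of r] assms(2) by simp
    show "?w z \<ge> 0" for z by (simp add: ebm_weight_def)
    fix t :: real assume t: "\<bar>t\<bar> \<le> r"
    note st = seg[OF t]
    show "integrable lebesgue (\<lambda>z. ?w z * exp (t * ?u z))"
      unfolding tilt using st by (simp add: eta_space_def)
    have "exp (t * c) * partition_function F T \<theta> \<eta> \<le> partition_function F T \<theta> (\<eta> + t *\<^sub>R b)"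
      unfolding c_def using log_likelihood_shift_le_iff[OF assms(1) eta] st by blast
    then show "(LINT z|lebesgue. ?w z) \<le> (LINT z|lebesgue. ?w z * exp (t * ?u z))"
      unfolding tilt by (simp add: partition_function_def exp_minus field_simps)
  qed
  then have iu: "integrable lebesgue (\<lambda>z. ?w z * ?u z)"
    and zero: "(LINT z|lebesgue. ?w z * ?u z) = 0" by auto
  \<comment> \<open>Undoing the centring: the first summand integrates to 0, the second to
    \<open>c\<close> times the partition function.\<close>
  have split: "?w z * (b \<bullet> T z) = ?w z * ?u z + c * ?w z" for z
    by (simp add: algebra_simps)
  show "integrable lebesgue (\<lambda>z. ?w z * (b \<bullet> T z))"
    unfolding split using iu iw by (intro Bochner_Integration.integrable_add integrable_mult_right)
  show "(LINT z|lebesgue. ?w z * (b \<bullet> T z)) = c * partition_function F T \<theta> \<eta>"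
    unfolding split using iu iw zero by (simp add: partition_function_def)
qed

text \<open>Integrability is part of the conclusion because the Bochner integral of a non-integrable
  function is 0 by default, so the equation alone would not assert that the mean exists. Interiority
  of \<open>\<eta>\<close> ensures that local maximality compares \<open>\<eta>\<close> with
  parameters at which the density exists.\<close>

theorem theorem1:
  fixes F :: "'p \<Rightarrow> real ^ 'd \<Rightarrow> real"
    and T :: "real ^ 'd \<Rightarrow> real ^ 'm"
    and \<theta> :: 'p
    and \<eta> :: "real ^ 'm"
    and N :: nat
    and x :: "nat \<Rightarrow> real ^ 'd"
  assumes "N \<ge> 1"
    and "\<eta> \<in> interior (eta_space F T \<theta>)"
    and "local_max_at (\<lambda>\<eta>'. log_likelihood F T N x \<theta> \<eta>') \<eta>"
  shows "integrable (ebm_measure F T \<theta> \<eta>) T \<and>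
    prob_space.expectation (ebm_measure F T \<theta> \<eta>) T = (1 / real N) *\<^sub>R (\<Sum>i=1..N. T (x i))"
proof -
  let ?w = "ebm_weight F T \<theta> \<eta>" and ?p = "ebm_pdf F T \<theta> \<eta>" and ?Z = "partition_function F T \<theta> \<eta>"
  let ?avg = "(1 / real N) *\<^sub>R (\<Sum>i=1..N. T (x i))"
  obtain r where r: "r > 0" and seg: "\<And>b t. norm b = 1 \<Longrightarrow> \<bar>t\<bar> \<le> r \<Longrightarrow>
      \<eta> + t *\<^sub>R b \<in> eta_space F T \<theta> \<and>
      log_likelihood F T N x \<theta> (\<eta> + t *\<^sub>R b) \<le> log_likelihood F T N x \<theta> \<eta>"
    using eta_interior_segment[OF assms(2,3)] by blast
  have eta: "\<eta> \<in> eta_space F T \<theta>" using assms(2) interior_subset by blast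
  then have iw: "integrable lebesgue ?w" by (simp add: eta_space_def)
  have Z: "?Z > 0" by (rule partition_function_pos[OF eta])
  have p_meas: "?p \<in> borel_measurable lebesgue"
    unfolding ebm_pdf_def using iw by measurable
  have p0: "AE z in lebesgue. 0 \<le> ?p z"
    using Z by (simp add: ebm_pdf_def ebm_weight_def)
  have component: "integrable lebesgue (\<lambda>z. ?p z * (T z \<bullet> b))"
    "(LINT z|lebesgue. ?p z * (T z \<bullet> b)) = ?avg \<bullet> b" if b: "b \<in> Basis" for b
  proof -
    have eq: "?p z * (T z \<bullet> b) = ?w z * (b \<bullet> T z) / ?Z" for z
      by (simp add: ebm_pdf_def inner_commute)
    note wsc = weighted_statistic_component[OF assms(1) r seg[OF norm_Basis[OF b]]]
    show "integrable lebesgue (\<lambda>z. ?p z * (T z \<bullet> b))"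
      unfolding eq using wsc(1) by simp
    show "(LINT z|lebesgue. ?p z * (T z \<bullet> b)) = ?avg \<bullet> b"
      unfolding eq using wsc(2) Z by (simp add: inner_commute)
  qed
  have T_meas: "T \<in> borel_measurable lebesgue"
  proof (subst borel_measurable_euclidean_space, rule ballI)
    fix b :: "real ^ 'm" assume "b \<in> Basis"
    then show "(\<lambda>z. T z \<bullet> b) \<in> borel_measurable lebesgue"
      using statistic_component_measurable[OF eta, of r b] seg[of b r] r
      by (simp add: inner_commute)
  qed
  \<comment> \<open>Integrability of the vector-valued integrand is assembled from its finitely many
    coordinates.\<close>
  have ipT: "integrable lebesgue (\<lambda>z. ?p z *\<^sub>R T z)"
  proof -
    have "?p z *\<^sub>R T z = (\<Sum>b\<in>Basis. (?p z * (T z \<bullet> b)) *\<^sub>R b)" for z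
      using euclidean_representation[of "?p z *\<^sub>R T z"] by simp
    then show ?thesis
      using component(1) by (simp add: Bochner_Integration.integrable_sum)
  qed
  have "(LINT z|lebesgue. ?p z *\<^sub>R T z) = ?avg"
  proof (rule euclidean_eqI)
    fix b :: "real ^ 'm" assume b: "b \<in> Basis"
    have "(LINT z|lebesgue. ?p z *\<^sub>R T z) \<bullet> b = (LINT z|lebesgue. (?p z *\<^sub>R T z) \<bullet> b)"
      by (rule integral_inner_left[symmetric]) (rule ipT)
    then show "(LINT z|lebesgue. ?p z *\<^sub>R T z) \<bullet> b = ?avg \<bullet> b"
      using component(2)[OF b] by simp
  qed
  \<comment> \<open>Integrals over \<open>ebm_measure\<close> become Lebesgue integrals weighted by
    the density, by measurability of \<open>T\<close> and of the density.\<close>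
  then show ?thesis
    unfolding ebm_measure_def
    using ipT integrable_density[OF T_meas p_meas p0] integral_density[OF T_meas p_meas p0] by simp
qed

end
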